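(* The order embedding $\mathfrak{B}$ from the Turing degrees to the generic degrees, defined by $\mathfrak{B}(\boldsymbol{a}) = \deg_g(\mathcal{R}(A))$ for any $A \in \boldsymbol{a}$, is not surjective; that is, there is a set $A \subseteq \omega$ such that there is no set $B \subseteq \omega$ with $A \equiv_g \mathcal{R}(B)$.
   Context: $\omega = \{0,1,2,\dots\}$. For $k \in \omega$, $R_k = \{ m \in \omega : 2^k \mid m,\ 2^{k+1} \nmid m \}$, and for $A \subseteq \omega$, $\mathcal{R}(A) = \bigcup_{n \in A} R_n$. The density of $S \subseteq \omega$ is $\lim_{n\to\infty} \frac{|S \cap [0,n]|}{n+1}$, when this limit exists. A generic description of $A \subseteq \omega$ is a partial function $\Psi$ from $\omega$ to $\{0,1\}$ which agrees with the characteristic function of $A$ on its domain and whose domain has density $1$. For a partial function $\Psi$, $\gamma(\Psi) = \{\langle a,b\rangle : \Psi(a) = b\}$, the set of codes of pairs in its graph. An enumeration operator is a c.e. set $W$, whose elements are viewed as codes of pairs $\langle n, D\rangle$ with $n \in \omega$ and $D \subseteq \omega$ finite (identified with its canonical index $\sum_{k\in D}2^k$); it acts on sets by $W(X) = \{ n : (\exists D)[\langle n, D\rangle \in W \ \&\ D \subseteq X]\}$. $A$ is generically reducible to $B$ ($A \leq_g B$) if there is an enumeration operator $W$ such that for every generic description $\Psi$ of $B$, $W(\gamma(\Psi)) = \gamma(\Theta)$ for some generic description $\Theta$ of $A$. The relation $\leq_g$ is reflexive and transitive; $A \equiv_g B$ means $A \leq_g B$ and $B \leq_g A$; the generic degree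 of $A$ is $\deg_g(A) = \{C : C \equiv_g A\}$. The map $\mathfrak{B}$ is well-defined because $A \leq_T B$ if and only if $\mathcal{R}(A) \leq_g \mathcal{R}(B)$. *)

theory Defs
  imports Complex_Main "HOL-Library.Nat_Bijection"
begin

text \<open>Partial recursive functions relative to an oracle. An argument list of unsuitable length
  makes a program undefined or is read through its initial entries; for each fixed length of the
  argument list, the functions computed are exactly the partial functions recursive in the
  oracle.\<close>

datatype recf =
    Zero
  | Succ
  | Proj nat
  | Oracle
  | Comp recf "recf list"
  | PrimRec recf recf
  | Mu recf

text \<open>Composition is strict. For the minimisation operator, \<open>Mu f\<close> has value \<open>n\<close> on \<open>xs\<close> iff
  \<open>f\<close> has value \<open>0\<close> on \<open>n # xs\<close> and is defined and nonzero on \<open>m # xs\<close> for all \<open>m < n\<close>.\<close>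

fun eval :: "nat set \<Rightarrow> recf \<Rightarrow> nat list \<Rightarrow> nat option" where
  "eval X Zero xs = Some 0"
| "eval X Succ xs = (case xs of [] \<Rightarrow> None | x # _ \<Rightarrow> Some (Suc x))"
| "eval X (Proj i) xs = (if i < length xs then Some (xs ! i) else None)"
| "eval X Oracle xs = (case xs of [] \<Rightarrow> None | x # _ \<Rightarrow> Some (of_bool (x \<in> X)))"
| "eval X (Comp f gs) xs =
     (if \<exists>g\<in>set gs. eval X g xs = None then None
      else eval X f (map (\<lambda>g. the (eval X g xs)) gs))"
| "eval X (PrimRec f g) xs =
     (case xs of [] \<Rightarrow> None
      | n # ys \<Rightarrow>
          rec_nat (eval X f ys) (\<lambda>m r. Option.bind r (\<lambda>y. eval X g (m # y # ys))) n)"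
| "eval X (Mu f) xs =
     (if \<exists>n. eval X f (n # xs) = Some 0 \<and> (\<forall>m<n. eval X f (m # xs) \<noteq> None)
      then Some (LEAST n. eval X f (n # xs) = Some 0) else None)"

definition turing_reducible :: "nat set \<Rightarrow> nat set \<Rightarrow> bool" (infix \<open>\<le>\<^sub>T\<close> 50) where
  "A \<le>\<^sub>T B \<longleftrightarrow> (\<exists>f. \<forall>x. eval B f [x] = Some (of_bool (x \<in> A)))"

definition turing_equivalent :: "nat set \<Rightarrow> nat set \<Rightarrow> bool" (infix \<open>\<equiv>\<^sub>T\<close> 50) where
  "A \<equiv>\<^sub>T B \<longleftrightarrow> A \<le>\<^sub>T B \<and> B \<le>\<^sub>T A"

definition turing_degree :: "nat set \<Rightarrow> nat set set" where
  "turing_degree A = {C. C \<equiv>\<^sub>T A}"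

text \<open>A computably enumerable set is the domain of a unary partial recursive function; unrelativised
  computability is computability relative to the empty oracle.\<close>

definition ce :: "nat set \<Rightarrow> bool" where
  "ce W \<longleftrightarrow> (\<exists>f. W = {n. eval {} f [n] \<noteq> None})"

definition R_part :: "nat \<Rightarrow> nat set" where
  "R_part k = {m. 2 ^ k dvd m \<and> \<not> 2 ^ (k + 1) dvd m}"

definition \<R> :: "nat set \<Rightarrow> nat set" where
  "\<R> A = (\<Union>n\<in>A. R_part n)"

definition has_density :: "nat set \<Rightarrow> real \<Rightarrow> bool" where
  "has_density S d \<longleftrightarrow> (\<lambda>n. real (card (S \<inter> {0..n})) / real (n + 1)) \<longlonglongrightarrow> d"

text \<open>Values in \<open>{0, 1}\<close> are forced by the agreement with the characteristic function.\<close>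

definition generic_description :: "(nat \<rightharpoonup> nat) \<Rightarrow> nat set \<Rightarrow> bool" where
  "generic_description \<Psi> A \<longleftrightarrow>
     (\<forall>a\<in>dom \<Psi>. \<Psi> a = Some (of_bool (a \<in> A))) \<and> has_density (dom \<Psi>) 1"

definition graph_code :: "(nat \<rightharpoonup> nat) \<Rightarrow> nat set" where
  "graph_code \<Psi> = {prod_encode (a, b) | a b. \<Psi> a = Some b}"

definition enum_apply :: "nat set \<Rightarrow> nat set \<Rightarrow> nat set" where
  "enum_apply W X = {n. \<exists>D. finite D \<and> prod_encode (n, set_encode D) \<in> W \<and> D \<subseteq> X}"

definition generic_reducible :: "nat set \<Rightarrow> nat set \<Rightarrow> bool" (infix \<open>\<le>\<^sub>g\<close> 50) where
  "A \<le>\<^sub>g B \<longleftrightarrow>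
     (\<exists>W. ce W \<and>
       (\<forall>\<Psi>. generic_description \<Psi> B \<longrightarrow>
         (\<exists>\<Theta>. generic_description \<Theta> A \<and> enum_apply W (graph_code \<Psi>) = graph_code \<Theta>)))"

definition generic_equivalent :: "nat set \<Rightarrow> nat set \<Rightarrow> bool" (infix \<open>\<equiv>\<^sub>g\<close> 50) where
  "A \<equiv>\<^sub>g B \<longleftrightarrow> A \<le>\<^sub>g B \<and> B \<le>\<^sub>g A"

definition generic_degree :: "nat set \<Rightarrow> nat set set" where
  "generic_degree A = {C. C \<equiv>\<^sub>g A}"

text \<open>The map on Turing degrees induced by \<open>A \<mapsto> generic_degree (\<R> A)\<close>. This is the usual lifting
  of a set-valued function to equivalence classes: as \<open>generic_degree (\<R> A)\<close> is the same set for
  all \<open>A\<close> in a Turing degree \<open>a\<close>, the union is this common value.\<close>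

definition \<BB> :: "nat set set \<Rightarrow> nat set set" where
  "\<BB> a = (\<Union>A\<in>a. generic_degree (\<R> A))"

end

theory Submission
  imports Defs "HOL-Library.Countable_Set" "HOL-Real_Asymp.Real_Asymp"
begin

text \<open>The witness is a set \<open>A\<close> of density \<open>1\<close>, so that the constant function \<open>1\<close> on \<open>A\<close> is a
  generic description of \<open>A\<close> carrying positive information only. The complement of \<open>A\<close> is a sparse
  sequence, chosen step by step to achieve two things.

  First, let \<open>W\<close> be an enumeration operator reducing \<open>\<R> B\<close> to \<open>A\<close>. As \<open>\<R> B\<close> is constant on every
  \<open>R_part k\<close>, the set that \<open>W\<close> enumerates from \<open>A\<close> must not contain opposite answers about two
  elements of one \<open>R_part k\<close>. Such a conflict would use only finitely many elements, so whenever
  \<open>W\<close> can still be made to conflict, some finite part of \<open>A\<close> is fixed to force this. For an actual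
  reduction it follows that \<open>W\<close> is free of conflicts even on some cofinite set \<open>X\<close> including \<open>A\<close>.
  Now a set of density \<open>1\<close> meets every \<open>R_part k\<close>, so \<open>W\<close> enumerates from \<open>A\<close>, hence from \<open>X\<close>, the
  correct answer for every \<open>k\<close>; and the answers from \<open>X\<close> are unambiguous. So the characteristic
  function of \<open>\<R> B\<close> can be read off from \<open>W\<close> and \<open>X\<close> (lemma \<open>saturate_eq_graph\<close>). In computability
  terms, \<open>B\<close> is computable.

  Second, if also \<open>A \<le>\<^sub>g \<R> B\<close> via \<open>W'\<close>, then \<open>W'\<close> applied to this characteristic function
  describes \<open>A\<close> generically, and its positive part is an infinite subset of \<open>A\<close>. This subset is
  determined by \<open>W\<close>, \<open>W'\<close> and \<open>X\<close>, so only countably many sets can arise in this way, and the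
  complement of \<open>A\<close> is made to meet every infinite one of them.

  Since counting the possible sets is enough, the only computation to be programmed is the identity
  operator. It makes \<open>\<le>\<^sub>g\<close> reflexive, so that \<open>A\<close> lies in its own generic degree; this turns the
  statement about sets into the one about degrees.\<close>

section \<open>Sets of density one\<close>

lemma has_density_UNIV: "has_density UNIV 1"
  unfolding has_density_def by simp

text \<open>As \<open>c e \<le> n\<close> forces \<open>e \<le> sqrt n\<close>, among the numbers up to \<open>n\<close> at most \<open>sqrt n + 1\<close> are removed.\<close>

lemma has_density_sparse_complement:
  fixes c :: "nat \<Rightarrow> nat"
  assumes sq: "\<And>e. e\<^sup>2 \<le> c e"
  shows "has_density (- range c) 1"
proof -
  have bound: "real (card (range c \<inter> {0..n})) \<le> sqrt (real n) + 1" for n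
  proof -
    define s where "s = nat \<lfloor>sqrt (real n)\<rfloor>"
    have "range c \<inter> {0..n} \<subseteq> c ` {..s}"
    proof
      fix x assume "x \<in> range c \<inter> {0..n}"
      then obtain e where e: "x = c e" "c e \<le> n" by auto
      with sq[of e] have "e\<^sup>2 \<le> n" by linarith
      then have "real e \<le> sqrt (real n)"
        by (metis of_nat_le_iff of_nat_power real_le_rsqrt)
      then have "e \<le> s" unfolding s_def by linarith
      with e show "x \<in> c ` {..s}" by auto
    qed
    then have "card (range c \<inter> {0..n}) \<le> card (c ` {..s})"
      by (intro card_mono) auto
    also have "\<dots> \<le> Suc s" using card_image_le[of "{..s}" c] by simp
    finally show ?thesis unfolding s_def
      by (smt (verit) of_nat_Suc of_nat_mono of_nat_nat of_int_floor_le real_sqrt_ge_zero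
          of_nat_0_le_iff zero_le_floor)
  qed
  have split: "real (card (- range c \<inter> {0..n})) = real (n + 1) - real (card (range c \<inter> {0..n}))" for n
  proof -
    have "card ({0..n} - range c \<inter> {0..n}) = card {0..n} - card (range c \<inter> {0..n})"
      by (intro card_Diff_subset) auto
    moreover have "{0..n} - range c \<inter> {0..n} = - range c \<inter> {0..n}" by auto
    moreover have "card (range c \<inter> {0..n}) \<le> card {0..n}" by (intro card_mono) auto
    ultimately show ?thesis by (simp add: of_nat_diff)
  qed
  show ?thesis unfolding has_density_def
  proof (rule tendsto_sandwich)
    show "\<forall>\<^sub>F n in sequentially. 1 - (sqrt (real n) + 1) / (real n + 1)
        \<le> real (card (- range c \<inter> {0..n})) / real (n + 1)"
    proof (rule always_eventually, rule allI)
      fix n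
      have "1 - (sqrt (real n) + 1) / (real n + 1) = (real (n + 1) - (sqrt (real n) + 1)) / real (n + 1)"
        by (simp add: field_simps)
      also have "\<dots> \<le> (real (n + 1) - real (card (range c \<inter> {0..n}))) / real (n + 1)"
        using bound[of n] by (intro divide_right_mono) auto
      finally show "1 - (sqrt (real n) + 1) / (real n + 1)
          \<le> real (card (- range c \<inter> {0..n})) / real (n + 1)"
        by (simp only: split)
    qed
    show "\<forall>\<^sub>F n in sequentially. real (card (- range c \<inter> {0..n})) / real (n + 1) \<le> 1"
      by (rule always_eventually) (auto simp: split)
    show "(\<lambda>n. 1 - (sqrt (real n) + 1) / (real n + 1)) \<longlonglongrightarrow> 1" by real_asymp
  qed auto
qed

text \<open>Otherwise the counting functions of the two sets would add up to at most \<open>n\<close> plus a constant,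
  and the two densities to at most \<open>1\<close>.\<close>

lemma infinite_Int_of_density_one:
  assumes S: "has_density S 1" and T: "has_density T 1"
  shows "infinite (S \<inter> T)"
proof
  assume fin: "finite (S \<inter> T)"
  define m where "m = card (S \<inter> T)"
  have "real (card (S \<inter> {0..n})) / real (n + 1) + real (card (T \<inter> {0..n})) / real (n + 1)
      \<le> 1 + real m / real (n + 1)" for n
  proof -
    have "card (S \<inter> {0..n}) + card (T \<inter> {0..n})
        = card ((S \<inter> {0..n}) \<union> (T \<inter> {0..n})) + card ((S \<inter> {0..n}) \<inter> (T \<inter> {0..n}))"
      by (rule card_Un_Int) auto
    also have "\<dots> \<le> card {0..n} + card (S \<inter> T)"
      using fin by (intro add_mono card_mono) auto
    finally have "card (S \<inter> {0..n}) + card (T \<inter> {0..n}) \<le> n + 1 + m" by (simp add: m_def)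
    then have "real (card (S \<inter> {0..n})) + real (card (T \<inter> {0..n})) \<le> real (n + 1) + real m"
      by linarith
    then have "(real (card (S \<inter> {0..n})) + real (card (T \<inter> {0..n}))) / real (n + 1)
        \<le> (real (n + 1) + real m) / real (n + 1)" by (intro divide_right_mono) auto
    then show ?thesis by (simp add: add_divide_distrib)
  qed
  moreover have "(\<lambda>n. 1 + real m / real (n + 1)) \<longlonglongrightarrow> 1" by real_asymp
  ultimately have "(1 + 1 :: real) \<le> 1"
    using S T unfolding has_density_def by (blast intro: LIMSEQ_le tendsto_add)
  then show False by simp
qed

section \<open>The partition underlying the map from sets to their spread-out copies\<close>

lemma R_part_disjoint:
  assumes "x \<in> R_part k" "x \<in> R_part l" shows "k = l"
proof -
  have "l \<le> k" if "x \<in> R_part k" "x \<in> R_part l" for k l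
  proof (rule ccontr)
    assume "\<not> l \<le> k"
    then have "(2::nat) ^ (k + 1) dvd 2 ^ l" by (intro le_imp_power_dvd) auto
    with that show False unfolding R_part_def using dvd_trans by blast
  qed
  with assms show ?thesis by (meson le_antisym)
qed

lemma mem_\<R>_iff:
  assumes "x \<in> R_part k" shows "x \<in> \<R> B \<longleftrightarrow> k \<in> B"
  using assms R_part_disjoint unfolding \<R>_def by blast

lemma zero_notin_\<R>: "0 \<notin> \<R> B"
  unfolding \<R>_def R_part_def by simp

lemma odd_multiple_in_R_part: "2 ^ k * (2 * j + 1) \<in> R_part k"
proof -
  have "\<not> (2::nat) ^ k * 2 dvd 2 ^ k * (2 * j + 1)"
    by (subst dvd_times_left_cancel_iff) auto
  then show ?thesis unfolding R_part_def by (simp add: mult.commute)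
qed

lemma ex_R_part:
  assumes "x > 0" shows "\<exists>k. x \<in> R_part k"
proof -
  obtain k where "2 ^ k dvd x" "\<not> 2 ^ Suc k dvd x"
  proof -
    have "\<not> 2 ^ x dvd x" using assms dvd_imp_le[of "2 ^ x" x] less_exp[of x] by linarith
    then show ?thesis using that ex_least_nat_less[of "\<lambda>k. \<not> 2 ^ k dvd x" x] by auto
  qed
  then show ?thesis unfolding R_part_def by auto
qed

text \<open>\<open>R_part k\<close> has \<open>m\<close> elements below \<open>2 ^ (k + 1) * m\<close>, a positive proportion.\<close>

lemma density_one_meets_R_part:
  assumes D: "has_density D 1"
  shows "\<exists>y\<in>D. y \<in> R_part k"
proof (rule ccontr)
  assume disj: "\<not> ?thesis"
  define N where "N m = 2 ^ (k + 1) * Suc m - 1" for m :: nat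
  have N: "N m + 1 = 2 ^ (k + 1) * Suc m" for m
    unfolding N_def using One_nat_def by simp
  have "N m + 1 < N (Suc m) + 1" for m unfolding N by simp
  then have "strict_mono N" by (simp add: strict_mono_Suc_iff)
  then have lim: "(\<lambda>m. real (card (D \<inter> {0..N m})) / real (N m + 1)) \<longlonglongrightarrow> 1"
    using LIMSEQ_subseq_LIMSEQ[OF D[unfolded has_density_def]] by (simp add: o_def)
  have "real (card (D \<inter> {0..N m})) / real (N m + 1) \<le> 1 - 1 / 2 ^ (k + 1)" for m
  proof -
    define E where "E = (\<lambda>j. 2 ^ k * (2 * j + 1)) ` {..m}"
    have cardE: "card E = Suc m" unfolding E_def by (subst card_image) (auto simp: inj_on_def)
    have "2 ^ k * (2 * j + 1) \<le> N m" if "j \<le> m" for j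
    proof -
      have "2 ^ k * (2 * j + 1) < (2::nat) ^ k * (2 * Suc m)"
        using that by (intro mult_strict_left_mono) auto
      then show ?thesis using N[of m] by (simp add: mult_ac)
    qed
    then have E: "E \<subseteq> {0..N m}" unfolding E_def by auto
    have "E \<subseteq> R_part k" unfolding E_def using odd_multiple_in_R_part by auto
    with disj have "D \<inter> {0..N m} \<subseteq> {0..N m} - E" by auto
    then have "card (D \<inter> {0..N m}) \<le> card ({0..N m} - E)" by (intro card_mono) auto
    also have "\<dots> = N m + 1 - Suc m"
      using E cardE by (subst card_Diff_subset) (auto intro: finite_subset)
    finally have "card (D \<inter> {0..N m}) \<le> N m + 1 - Suc m" .
    moreover have "Suc m \<le> N m + 1" using mult_le_mono1[of 1 "2 ^ (k + 1)" "Suc m"]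
      unfolding N by (simp only: mult_1 one_le_power one_le_numeral)
    ultimately have "real (card (D \<inter> {0..N m})) \<le> real (N m + 1) - real (Suc m)" by linarith
    then have "real (card (D \<inter> {0..N m})) / real (N m + 1)
        \<le> (real (N m + 1) - real (Suc m)) / real (N m + 1)" by (intro divide_right_mono) auto
    also have "\<dots> = 1 - real (Suc m) / real (N m + 1)" by (simp add: diff_divide_distrib del: of_nat_add of_nat_Suc)
    also have "\<dots> = 1 - real (Suc m) / (2 ^ (k + 1) * real (Suc m))"
      unfolding N of_nat_mult of_nat_power of_nat_numeral ..
    also have "\<dots> = 1 - 1 / 2 ^ (k + 1)"
      by (subst nonzero_divide_mult_cancel_right) auto
    finally show ?thesis .
  qed
  with lim have "(1::real) \<le> 1 - 1 / 2 ^ (k + 1)" by (intro LIMSEQ_le_const2) auto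
  moreover have "(0::real) < 1 / 2 ^ (k + 1)" by simp
  ultimately show False by linarith
qed

section \<open>Thin complements\<close>

text \<open>The properties in \<open>\<K>\<close> are those that, once true, are witnessed by finitely many elements. The
  complement of \<open>A\<close> is chosen one element at a time, in increasing order. At a step with finite set
  \<open>S\<close> of elements chosen so far, if \<open>K (- S)\<close> holds, then all later elements are taken above some
  finite witness, which thus becomes part of \<open>A\<close>; otherwise \<open>- S\<close> is the required cofinite set.\<close>

lemma density_one_set_deciding:
  fixes \<P> :: "nat set set" and \<K> :: "(nat set \<Rightarrow> bool) set"
  assumes "countable \<P>" and "countable \<K>"
    and finitary: "\<And>K X. K \<in> \<K> \<Longrightarrow> K X \<longleftrightarrow> (\<exists>F. finite F \<and> F \<subseteq> X \<and> K F)"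
  obtains A where "has_density A 1"
    and "\<And>P. P \<in> \<P> \<Longrightarrow> infinite P \<Longrightarrow> \<not> P \<subseteq> A"
    and "\<And>K. K \<in> \<K> \<Longrightarrow> K A \<or> (\<exists>X. finite (- X) \<and> A \<subseteq> X \<and> \<not> K X)"
proof -
  \<comment> \<open>Harmless extra members make both families nonempty, so that they can be enumerated.\<close>
  define P where "P = from_nat_into (insert {} \<P>)"
  define K where "K = from_nat_into (insert (\<lambda>X. False) \<K>)"
  have P: "range P = insert {} \<P>" and K: "range K = insert (\<lambda>X. False) \<K>"
    unfolding P_def K_def using assms(1,2) by (simp_all add: range_from_nat_into)
  have fin_K: "K e X \<longleftrightarrow> (\<exists>F. finite F \<and> F \<subseteq> X \<and> K e F)" for e X
  proof -
    from K have "K e \<in> insert (\<lambda>X. False) \<K>" by auto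
    then show ?thesis using finitary by auto
  qed
  define step where "step e S c \<longleftrightarrow> e\<^sup>2 \<le> c \<and> (\<forall>x\<in>S. x < c) \<and> (infinite (P e) \<longrightarrow> c \<in> P e)
      \<and> (\<not> K e (- S) \<or> K e ({..<c} - S))" for e S c
  have ex_step: "\<exists>c. step e S c" if "finite S" for e S
  proof -
    obtain F where F: "finite F" "F \<subseteq> - S" "K e (- S) \<longrightarrow> K e F"
      using fin_K[of e "- S"] by blast
    define N where "N = Suc (Max (insert (e\<^sup>2) (S \<union> F)))"
    have N: "x < N" if "x \<in> insert (e\<^sup>2) (S \<union> F)" for x
      unfolding N_def using that \<open>finite S\<close> F(1)
      by (meson Max_ge finite_Un finite_insert le_imp_less_Suc)
    obtain c where c: "N \<le> c" "infinite (P e) \<longrightarrow> c \<in> P e"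
      using infinite_nat_iff_unbounded_le[of "P e"] by blast
    have "F \<subseteq> {..<c} - S" using F(2) N c(1) by fastforce
    then have "\<not> K e (- S) \<or> K e ({..<c} - S)" using F(1,3) fin_K by blast
    with c N show ?thesis unfolding step_def
      by (metis Un_iff insert_iff le_trans less_imp_le less_le_trans)
  qed
  have "\<exists>S. \<forall>e. (finite (S e) \<and> (e = 0 \<longrightarrow> S e = {}))
      \<and> (\<exists>c. S (Suc e) = insert c (S e) \<and> step e (S e) c)"
  proof (rule dependent_nat_choice)
    show "\<exists>S. finite S \<and> (0 = (0::nat) \<longrightarrow> S = {})" by blast
    show "\<exists>S'. (finite S' \<and> (Suc e = 0 \<longrightarrow> S' = {})) \<and> (\<exists>c. S' = insert c S \<and> step e S c)"
      if "finite S \<and> (e = 0 \<longrightarrow> S = {})" for S e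
    proof -
      from that ex_step obtain c where "step e S c" by blast
      with that show ?thesis by (intro exI[of _ "insert c S"]) auto
    qed
  qed
  then obtain S where S: "\<And>e. finite (S e)" "S 0 = {}"
    "\<And>e. \<exists>c. S (Suc e) = insert c (S e) \<and> step e (S e) c" by blast
  from S(3) obtain c where c: "\<And>e. S (Suc e) = insert (c e) (S e)" "\<And>e. step e (S e) (c e)"
    by metis
  have S_eq: "S e = c ` {..<e}" for e
    by (induction e) (simp_all add: S(2) c(1) lessThan_Suc)
  have mono: "strict_mono c"
    by (rule strict_monoI) (use c(2) in \<open>auto simp: step_def S_eq\<close>)
  define A where "A = - range c"
  show ?thesis
  proof (rule that)
    show "has_density A 1" unfolding A_def
      by (rule has_density_sparse_complement) (use c(2) step_def in blast)
    show "\<not> Q \<subseteq> A" if "Q \<in> \<P>" "infinite Q" for Q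
    proof -
      from P that(1) have "Q \<in> range P" by simp
      then obtain e where "Q = P e" by blast
      with c(2)[of e] that(2) have "c e \<in> Q" unfolding step_def by simp
      then show ?thesis unfolding A_def by auto
    qed
    show "L A \<or> (\<exists>X. finite (- X) \<and> A \<subseteq> X \<and> \<not> L X)" if "L \<in> \<K>" for L
    proof -
      from K that have "L \<in> range K" by simp
      then obtain e where e: "L = K e" by blast
      have AS: "A \<subseteq> - S e" unfolding A_def S_eq by auto
      have "{..<c e} - S e \<subseteq> A"
        unfolding A_def S_eq using strict_mono_less[OF mono] by auto
      moreover from c(2)[of e] have "\<not> K e (- S e) \<or> K e ({..<c e} - S e)"
        unfolding step_def by simp
      ultimately have "\<not> K e (- S e) \<or> K e A"
        using fin_K[of e A] fin_K[of e "{..<c e} - S e"] by (meson subset_trans)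
      moreover have "finite (- (- S e))" using S(1) by simp
      ultimately show ?thesis using AS e by blast
    qed
  qed
qed

section \<open>Enumeration operators\<close>

lemma enum_apply_mono: "X \<subseteq> Y \<Longrightarrow> enum_apply W X \<subseteq> enum_apply W Y"
  unfolding enum_apply_def by blast

lemma mem_graph_code [simp]: "prod_encode (a, b) \<in> graph_code \<Psi> \<longleftrightarrow> \<Psi> a = Some b"
  unfolding graph_code_def by (auto dest: inj_onD[OF inj_prod_encode])

text \<open>This graph is written as an image so that its finite subsets are plainly the sets \<open>ones F\<close> with
  \<open>F \<subseteq> X\<close> finite.\<close>

definition ones :: "nat set \<Rightarrow> nat set" where
  "ones X = (\<lambda>a. prod_encode (a, 1)) ` X"

lemma ones_mono: "X \<subseteq> Y \<Longrightarrow> ones X \<subseteq> ones Y"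
  unfolding ones_def by blast

lemma ones_eq_graph_code: "ones A = graph_code (\<lambda>a. if a \<in> A then Some 1 else None)"
  unfolding ones_def graph_code_def by (auto split: if_splits)

lemma generic_description_ones:
  assumes "has_density A 1"
  shows "generic_description (\<lambda>a. if a \<in> A then Some 1 else None) A"
proof -
  have "dom (\<lambda>a. if a \<in> A then Some (1::nat) else None) = A" by (auto split: if_splits)
  with assms show ?thesis unfolding generic_description_def by auto
qed

lemma enum_apply_ones_finitary:
  assumes "n \<in> enum_apply W (ones X)"
  shows "\<exists>F. finite F \<and> F \<subseteq> X \<and> n \<in> enum_apply W (ones F)"
proof -
  obtain D where D: "finite D" "prod_encode (n, set_encode D) \<in> W" "D \<subseteq> ones X"
    using assms unfolding enum_apply_def by blast
  then obtain F where "F \<subseteq> X" "finite F" "D = ones F"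
    unfolding ones_def by (metis finite_subset_image)
  with D show ?thesis unfolding enum_apply_def by blast
qed

text \<open>From the set \<open>X\<close>, the operator \<open>W\<close> gives both answers about a single \<open>R_part k\<close>. No
  description of a set \<open>\<R> B\<close> does this.\<close>

definition conflict :: "nat set \<Rightarrow> nat set \<Rightarrow> bool" where
  "conflict W X \<longleftrightarrow> (\<exists>k x y. x \<in> R_part k \<and> y \<in> R_part k
     \<and> prod_encode (x, 1) \<in> enum_apply W (ones X) \<and> prod_encode (y, 0) \<in> enum_apply W (ones X))"

lemma conflict_finitary: "conflict W X \<longleftrightarrow> (\<exists>F. finite F \<and> F \<subseteq> X \<and> conflict W F)"
proof
  assume "conflict W X"
  then obtain k x y where k: "x \<in> R_part k" "y \<in> R_part k"
    and x: "prod_encode (x, 1) \<in> enum_apply W (ones X)"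
    and y: "prod_encode (y, 0) \<in> enum_apply W (ones X)"
    unfolding conflict_def by blast
  obtain F where F: "finite F" "F \<subseteq> X" "prod_encode (x, 1) \<in> enum_apply W (ones F)"
    using enum_apply_ones_finitary[OF x] by blast
  obtain G where G: "finite G" "G \<subseteq> X" "prod_encode (y, 0) \<in> enum_apply W (ones G)"
    using enum_apply_ones_finitary[OF y] by blast
  have "enum_apply W (ones F) \<subseteq> enum_apply W (ones (F \<union> G))"
    "enum_apply W (ones G) \<subseteq> enum_apply W (ones (F \<union> G))"
    by (intro enum_apply_mono ones_mono; blast)+
  then have "conflict W (F \<union> G)"
    unfolding conflict_def using k F(3) G(3) by blast
  with F G show "\<exists>F. finite F \<and> F \<subseteq> X \<and> conflict W F"
    by (intro exI[of _ "F \<union> G"]) auto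
next
  assume "\<exists>F. finite F \<and> F \<subseteq> X \<and> conflict W F"
  then obtain F where "F \<subseteq> X" "conflict W F" by blast
  moreover from this have "enum_apply W (ones F) \<subseteq> enum_apply W (ones X)"
    by (intro enum_apply_mono ones_mono)
  ultimately show "conflict W X" unfolding conflict_def by blast
qed

text \<open>Every answer in \<open>V\<close> is spread over the whole \<open>R_part k\<close> to which it belongs. The number \<open>0\<close>
  lies in no \<open>R_part k\<close> and hence in no set \<open>\<R> B\<close>, so its value is always \<open>0\<close>.\<close>

definition saturate :: "nat set \<Rightarrow> nat set" where
  "saturate V = {prod_encode (x, of_bool b) | x b k y.
     x \<in> R_part k \<and> y \<in> R_part k \<and> prod_encode (y, of_bool b) \<in> V} \<union> {prod_encode (0, 0)}"

text \<open>All answers of \<open>\<Theta>\<close> are among those that \<open>W\<close> enumerates from the larger set \<open>X\<close>. As the domain of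
  \<open>\<Theta>\<close> meets every \<open>R_part k\<close>, the correct answer about \<open>k\<close> occurs, and a wrong one would be in
  conflict with it.\<close>

lemma saturate_eq_graph:
  assumes \<Theta>: "generic_description \<Theta> (\<R> B)"
    and sub: "graph_code \<Theta> \<subseteq> enum_apply W (ones X)"
    and free: "\<not> conflict W X"
  shows "saturate (enum_apply W (ones X)) = graph_code (\<lambda>x. Some (of_bool (x \<in> \<R> B)))"
    (is "saturate ?V = ?G")
proof -
  have correct: "\<exists>y. y \<in> R_part k \<and> prod_encode (y, of_bool (k \<in> B)) \<in> ?V" for k
  proof -
    obtain y where y: "y \<in> dom \<Theta>" "y \<in> R_part k"
      using density_one_meets_R_part \<Theta> unfolding generic_description_def by blast
    have "\<Theta> y = Some (of_bool (y \<in> \<R> B))"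
      using \<Theta> y(1) unfolding generic_description_def by blast
    then have "\<Theta> y = Some (of_bool (k \<in> B))" using mem_\<R>_iff[OF y(2)] by simp
    with sub y(2) show ?thesis using mem_graph_code by blast
  qed
  have unique: "b = (k \<in> B)" if "y \<in> R_part k" "prod_encode (y, of_bool b) \<in> ?V" for y b k
  proof (rule ccontr)
    assume b: "b \<noteq> (k \<in> B)"
    obtain y' where y': "y' \<in> R_part k" "prod_encode (y', of_bool (k \<in> B)) \<in> ?V"
      using correct[of k] by blast
    show False
    proof (cases b)
      case True
      with b that y' have "prod_encode (y, 1) \<in> ?V" "prod_encode (y', 0) \<in> ?V" by simp_all
      with that(1) y'(1) free show False unfolding conflict_def by blast
    next
      case False
      with b that y' have "prod_encode (y', 1) \<in> ?V" "prod_encode (y, 0) \<in> ?V" by simp_all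
      with that(1) y'(1) free show False unfolding conflict_def by blast
    qed
  qed
  show ?thesis
  proof
    show "saturate ?V \<subseteq> ?G"
    proof
      fix z assume "z \<in> saturate ?V"
      then consider x b k y where "z = prod_encode (x, of_bool b)" "x \<in> R_part k" "y \<in> R_part k"
          "prod_encode (y, of_bool b) \<in> ?V"
        | "z = prod_encode (0, 0)"
        unfolding saturate_def by blast
      then show "z \<in> ?G"
      proof cases
        case (1 x b k y)
        then have "b = (x \<in> \<R> B)" using unique mem_\<R>_iff by blast
        with 1 show ?thesis by simp
      next
        case 2
        then show ?thesis by (simp add: zero_notin_\<R>)
      qed
    qed
    show "?G \<subseteq> saturate ?V"
    proof
      fix z assume "z \<in> ?G"
      then obtain x where z: "z = prod_encode (x, of_bool (x \<in> \<R> B))"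
        unfolding graph_code_def by blast
      show "z \<in> saturate ?V"
      proof (cases "x = 0")
        case True
        with z show ?thesis unfolding saturate_def by (simp add: zero_notin_\<R>)
      next
        case False
        then obtain k where x: "x \<in> R_part k" using ex_R_part by blast
        then have "z = prod_encode (x, of_bool (k \<in> B))" using z mem_\<R>_iff by simp
        with x correct[of k] show ?thesis unfolding saturate_def by blast
      qed
    qed
  qed
qed

section \<open>The identity operator\<close>

instance recf :: countable
  by countable_datatype

lemma countable_ce: "countable {W. ce W}"
proof -
  have "{W. ce W} = range (\<lambda>f. {n. eval {} f [n] \<noteq> None})"
    unfolding ce_def by auto
  then show ?thesis by simp
qed

text \<open>Programs for \<open>n + m\<close>, \<open>m - n\<close> (the first argument is subtracted), \<open>2 ^ n\<close> and \<open>triangle n\<close>.\<close>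

definition "add_prog = PrimRec (Proj 0) (Comp Succ [Proj 1])"
definition "pred_prog = PrimRec Zero (Proj 0)"
definition "monus_prog = PrimRec (Proj 0) (Comp pred_prog [Proj 1])"
definition "pow2_prog = PrimRec (Comp Succ [Zero]) (Comp add_prog [Proj 1, Proj 1])"
definition "triangle_prog = PrimRec Zero (Comp add_prog [Proj 1, Comp Succ [Proj 0]])"

lemma eval_add_prog [simp]: "eval X add_prog (n # m # xs) = Some (n + m)"
  unfolding add_prog_def by (induction n) auto

lemma eval_pred_prog [simp]: "eval X pred_prog (n # xs) = Some (n - 1)"
  unfolding pred_prog_def by (induction n) auto

lemma eval_monus_prog [simp]: "eval X monus_prog (n # m # xs) = Some (m - n)"
  unfolding monus_prog_def by (induction n) auto

lemma eval_pow2_prog [simp]: "eval X pow2_prog (n # xs) = Some (2 ^ n)"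
  unfolding pow2_prog_def by (induction n) auto

lemma eval_triangle_prog [simp]: "eval X triangle_prog (n # xs) = Some (triangle n)"
  unfolding triangle_prog_def by (induction n) auto

text \<open>On the argument \<open>z\<close>, the program searches for a number \<open>n\<close> with
  \<open>z = prod_encode (n, 2 ^ n)\<close>; here \<open>2 ^ n\<close> is the canonical index of \<open>{n}\<close>. Equality is tested by
  adding the two truncated differences.\<close>

definition "pair_prog = Comp add_prog [Comp triangle_prog
   [Comp add_prog [Proj 0, Comp pow2_prog [Proj 0]]], Proj 0]"
definition "search_prog = Mu (Comp add_prog
   [Comp monus_prog [pair_prog, Proj 1], Comp monus_prog [Proj 1, pair_prog]])"

lemma eval_pair_prog [simp]: "eval X pair_prog (n # xs) = Some (prod_encode (n, 2 ^ n))"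
  unfolding pair_prog_def by (simp add: prod_encode_def)

lemma ce_identity: "ce {prod_encode (n, set_encode {n}) | n. True}"
proof -
  have "eval {} search_prog [z] \<noteq> None \<longleftrightarrow> (\<exists>n. z = prod_encode (n, 2 ^ n))" for z
    unfolding search_prog_def by (auto intro: le_antisym)
  then show ?thesis unfolding ce_def by (intro exI[of _ search_prog]) auto
qed

lemma enum_apply_identity: "enum_apply {prod_encode (n, set_encode {n}) | n. True} X = X"
proof -
  have "D = {n}" if "finite D" "prod_encode (n, set_encode D) = prod_encode (m, set_encode {m})"
    for D and n m :: nat
  proof -
    from that(2) have "n = m" "set_encode D = set_encode {m}"
      by (auto dest!: inj_onD[OF inj_prod_encode])
    with that(1) show ?thesis by (simp only: set_encode_eq finite.intros)
  qed
  then show ?thesis unfolding enum_apply_def by blast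
qed

lemma generic_reducible_refl: "A \<le>\<^sub>g A"
  unfolding generic_reducible_def using ce_identity enum_apply_identity by blast

section \<open>A set equivalent to no spread-out copy\<close>

lemma ex_not_generic_equivalent_\<R>: "\<exists>A. \<forall>B. \<not> A \<equiv>\<^sub>g \<R> B"
proof -
  \<comment> \<open>If \<open>W\<close> on \<open>X\<close> determines \<open>\<R> B\<close>, then \<open>pos W W' X\<close> is the set of those numbers that \<open>W'\<close>,
    applied to the characteristic function of \<open>\<R> B\<close>, puts into \<open>A\<close>.\<close>
  define pos where "pos W W' X = {x. prod_encode (x, 1)
     \<in> enum_apply W' (saturate (enum_apply W (ones X)))}" for W W' X
  define \<P> where "\<P> = (\<lambda>(W, W', X). pos W W' X) ` ({W. ce W} \<times> {W. ce W} \<times> {X. finite (- X)})"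
  have "{X :: nat set. finite (- X)} \<subseteq> uminus ` {S. finite S}"
    by (metis (mono_tags) double_complement image_eqI mem_Collect_eq subsetI)
  then have "countable {X :: nat set. finite (- X)}"
    by (rule countable_subset) (intro countable_image uncountable_infinite countable_Collect_finite)
  then have "countable \<P>"
    unfolding \<P>_def by (intro countable_image countable_SIGMA countable_ce)
  moreover have "countable (conflict ` {W. ce W})"
    using countable_ce by (rule countable_image)
  moreover have "K X \<longleftrightarrow> (\<exists>F. finite F \<and> F \<subseteq> X \<and> K F)"
    if "K \<in> conflict ` {W. ce W}" for K X
    using that conflict_finitary by blast
  ultimately obtain A where A: "has_density A 1"
    and thin: "\<And>P. P \<in> \<P> \<Longrightarrow> infinite P \<Longrightarrow> \<not> P \<subseteq> A"
    and decide: "\<And>K. K \<in> conflict ` {W. ce W} \<Longrightarrow> K A \<or> (\<exists>X. finite (- X) \<and> A \<subseteq> X \<and> \<not> K X)"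
    using density_one_set_deciding[of \<P> "conflict ` {W. ce W}"] by blast
  have "\<not> A \<equiv>\<^sub>g \<R> B" for B
  proof
    assume "A \<equiv>\<^sub>g \<R> B"
    then have "\<R> B \<le>\<^sub>g A" "A \<le>\<^sub>g \<R> B" unfolding generic_equivalent_def by auto
    then obtain W \<Theta> W' where W: "ce W" and \<Theta>: "generic_description \<Theta> (\<R> B)"
      and W\<Theta>: "enum_apply W (ones A) = graph_code \<Theta>"
      and W': "ce W'" and red: "\<And>\<Psi>. generic_description \<Psi> (\<R> B) \<Longrightarrow>
        \<exists>\<Theta>. generic_description \<Theta> A \<and> enum_apply W' (graph_code \<Psi>) = graph_code \<Theta>"
      using generic_description_ones[OF A] unfolding generic_reducible_def ones_eq_graph_code by blast
    have "\<not> conflict W A"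
    proof
      assume "conflict W A"
      then obtain k x y where "x \<in> R_part k" "y \<in> R_part k" "\<Theta> x = Some 1" "\<Theta> y = Some 0"
        unfolding conflict_def W\<Theta> mem_graph_code by blast
      moreover have "\<Theta> z = Some (of_bool (z \<in> \<R> B))" if "z \<in> dom \<Theta>" for z
        using \<Theta> that unfolding generic_description_def by blast
      ultimately have "x \<in> \<R> B" "y \<notin> \<R> B"
        by (metis domI of_bool_eq_0_iff of_bool_eq_1_iff option.inject)+
      with \<open>x \<in> R_part k\<close> \<open>y \<in> R_part k\<close> show False using mem_\<R>_iff by blast
    qed
    then obtain X where X: "finite (- X)" "A \<subseteq> X" "\<not> conflict W X"
      using decide[of "conflict W"] W by blast
    have "graph_code \<Theta> \<subseteq> enum_apply W (ones X)"
      using enum_apply_mono[OF ones_mono[OF X(2)], of W] W\<Theta> by simp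
    then have sat: "saturate (enum_apply W (ones X)) = graph_code (\<lambda>x. Some (of_bool (x \<in> \<R> B)))"
      using saturate_eq_graph \<Theta> X(3) by blast
    have "generic_description (\<lambda>x. Some (of_bool (x \<in> \<R> B))) (\<R> B)"
      unfolding generic_description_def by (simp add: dom_def has_density_UNIV)
    from red[OF this] obtain \<Phi> where \<Phi>: "generic_description \<Phi> A"
      and pos: "pos W W' X = {x. \<Phi> x = Some 1}"
      unfolding pos_def sat by auto
    have "\<Phi> x = Some (of_bool (x \<in> A))" if "x \<in> dom \<Phi>" for x
      using \<Phi> that unfolding generic_description_def by blast
    then have "\<Phi> x = Some 1 \<longleftrightarrow> x \<in> dom \<Phi> \<inter> A" for x
      by (metis IntD1 IntD2 IntI domI of_bool_eq_1_iff option.inject)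
    then have "{x. \<Phi> x = Some 1} = dom \<Phi> \<inter> A" by blast
    with pos have pos_eq: "pos W W' X = dom \<Phi> \<inter> A" by simp
    then have "infinite (pos W W' X)"
      using infinite_Int_of_density_one \<Phi> A unfolding generic_description_def by simp
    moreover have "pos W W' X \<in> \<P>" unfolding \<P>_def using W W' X(1) by force
    ultimately show False using thin pos_eq by blast
  qed
  then show ?thesis by blast
qed

text \<open>A set lies in its own generic degree. So if \<open>\<BB> a\<close> is the generic degree of \<open>A\<close>, then \<open>A\<close> is
  generically equivalent to \<open>\<R> B\<close> for some \<open>B\<close> in \<open>a\<close>.\<close>

theorem theorem4p8:
  "\<not> (\<forall>d \<in> range generic_degree. \<exists>a \<in> range turing_degree. \<BB> a = d) \<and>
   (\<exists>A :: nat set. \<not> (\<exists>B :: nat set. A \<equiv>\<^sub>g \<R> B))"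
proof -
  obtain A where A: "\<And>B. \<not> A \<equiv>\<^sub>g \<R> B" using ex_not_generic_equivalent_\<R> by blast
  have "A \<in> generic_degree A"
    unfolding generic_degree_def generic_equivalent_def by (simp add: generic_reducible_refl)
  moreover have "A \<notin> \<BB> a" for a
    unfolding \<BB>_def generic_degree_def using A by blast
  ultimately have "\<not> (\<exists>a \<in> range turing_degree. \<BB> a = generic_degree A)" by blast
  with A show ?thesis by blast
qed

end
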